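(* For all integers $r \geq 1$ and $1 \leq s \leq k \leq m$, $$\eta_{r,s,k}(m) = F_{r,s+1,k+1}(m+1).$$
   Context: All sequences are finite. A block is a contiguous, possibly empty, segment of a sequence whose letters are pairwise distinct. A sequence is on $m$ blocks if it is given as a concatenation of $m$ consecutive blocks. An $(r,s)$-formation is a concatenation of $s$ (not necessarily equal) permutations of the same $r$ distinct letters; e.g. $abcd\,dcba\,adbc$ is a $(4,3)$-formation. A sequence avoids every $(r,s)$-formation if none of its (not necessarily contiguous) subsequences is an $(r,s)$-formation. For positive integers $r,s,k,m$, $F_{r,s,k}(m)$ is the maximum number of distinct letters in a sequence on $m$ blocks that avoids every $(r,s)$-formation and in which every letter that occurs does so at least $k$ times (the empty sequence is allowed). A $k$-chain on $[1,m]$ is a sequence of $k$ consecutive, disjoint, nonempty intervals of integers $[a_0,a_1]\,[a_1+1,a_2]\cdots[a_{k-1}+1,a_k]$ with integers $1\leq a_0\leq a_1<a_2<\cdots<a_k\leq m$. An $s$-tuple is a set of $s$ distinct integers; it stabs a chain if each of its elements lies in an interval of the chain, with different elements lying in different intervals. $\eta_{r,s,k}(m)$ is the maximum size of a collection (multiset) $X$ of not necessarily distinct $k$-chains on $[1,m]$ such that there do not exist $r$ elements of $X$ (counted with multiplicity) all stabbed by the same $s$-tuple. *)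

theory Defs
  imports
    "HOL-Library.Multiset"
    "HOL-Library.Sublist"
    "HOL-Combinatorics.Multiset_Permutations"
begin

definition on_blocks :: "nat \<Rightarrow> 'a list \<Rightarrow> bool" where
  "on_blocks m xs \<longleftrightarrow> (\<exists>bs. length bs = m \<and> (\<forall>b\<in>set bs. distinct b) \<and> xs = concat bs)"

definition formation :: "nat \<Rightarrow> nat \<Rightarrow> 'a list \<Rightarrow> bool" where
  "formation r s xs \<longleftrightarrow>
     (\<exists>A ps. finite A \<and> card A = r \<and> length ps = s \<and>
        (\<forall>p\<in>set ps. p \<in> permutations_of_set A) \<and> xs = concat ps)"

definition avoids_formations :: "nat \<Rightarrow> nat \<Rightarrow> 'a list \<Rightarrow> bool" where
  "avoids_formations r s xs \<longleftrightarrow> \<not> (\<exists>ys. subseq ys xs \<and> formation r s ys)"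

text \<open>The alphabet is \<^typ>\<open>nat\<close>; any infinite alphabet gives the same values.
  In general \<^term>\<open>F_sizes r s k m\<close> may be infinite (for instance if \<open>s > k\<close>), and then the
  value of \<open>F\<close> is unspecified; see \<open>finite_F_sizes\<close> for the case \<open>s \<le> k\<close>.\<close>

definition F_sizes :: "nat \<Rightarrow> nat \<Rightarrow> nat \<Rightarrow> nat \<Rightarrow> nat set" where
  "F_sizes r s k m =
     {card (set xs) | xs :: nat list.
        on_blocks m xs \<and> avoids_formations r s xs \<and> (\<forall>a\<in>set xs. k \<le> count_list xs a)}"

definition F :: "nat \<Rightarrow> nat \<Rightarrow> nat \<Rightarrow> nat \<Rightarrow> nat" where
  "F r s k m = Max (F_sizes r s k m)"

text \<open>A chain is encoded as the list of its intervals. The bounds are as intended for \<open>k \<ge> 1\<close>.\<close>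

definition is_chain :: "nat \<Rightarrow> nat \<Rightarrow> int set list \<Rightarrow> bool" where
  "is_chain k m C \<longleftrightarrow>
     (\<exists>a :: nat \<Rightarrow> int. 1 \<le> a 0 \<and> a 0 \<le> a 1 \<and> (\<forall>i\<in>{1..<k}. a i < a (Suc i)) \<and> a k \<le> int m \<and>
        C = map (\<lambda>i. if i = 0 then {a 0..a 1} else {a i + 1..a (Suc i)}) [0..<k])"

definition stabs :: "int set \<Rightarrow> int set list \<Rightarrow> bool" where
  "stabs T C \<longleftrightarrow> (\<exists>f. inj_on f T \<and> (\<forall>t\<in>T. f t < length C \<and> t \<in> C ! f t))"

definition eta_sizes :: "nat \<Rightarrow> nat \<Rightarrow> nat \<Rightarrow> nat \<Rightarrow> nat set" where
  "eta_sizes r s k m =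
     {size X | X :: int set list multiset.
        (\<forall>C\<in>#X. is_chain k m C) \<and>
        \<not> (\<exists>Y T. Y \<subseteq># X \<and> size Y = r \<and> finite T \<and> card T = s \<and> (\<forall>C\<in>#Y. stabs T C))}"

definition eta :: "nat \<Rightarrow> nat \<Rightarrow> nat \<Rightarrow> nat \<Rightarrow> nat" where
  "eta r s k m = Max (eta_sizes r s k m)"


text \<open>Both maxima exist in the relevant range of parameters.\<close>

lemma F_sizes_nonempty:
  assumes "1 \<le> r" "1 \<le> s"
  shows "0 \<in> F_sizes r s k m"
proof -
  have "on_blocks m ([] :: nat list)"
    unfolding on_blocks_def by (rule exI[of _ "replicate m []"]) auto
  moreover have "\<not> formation r s ([] :: nat list)"
  proof
    assume "formation r s ([] :: nat list)"
    then obtain A :: "nat set" and ps where *: "card A = r" "length ps = s"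
      "\<forall>p\<in>set ps. p \<in> permutations_of_set A" "concat ps = []"
      unfolding formation_def by metis
    from * assms obtain p where "p \<in> set ps" by (cases ps) auto
    with * have "p = []" "p \<in> permutations_of_set A" by auto
    with * assms show False by (auto simp: permutations_of_set_def)
  qed
  ultimately have "on_blocks m ([] :: nat list) \<and> avoids_formations r s ([] :: nat list)"
    unfolding avoids_formations_def by (metis list_emb_Nil2)
  then show ?thesis unfolding F_sizes_def by force
qed

lemma count_list_concat_distinct:
  assumes "\<forall>b\<in>set bs. distinct b \<and> a \<in> set b"
  shows "count_list (concat bs) a = length bs"
proof -
  have "count_list b a = 1" if "distinct b" "a \<in> set b" for b
    using that by (induction b) (auto simp: count_list_0_iff)
  then show ?thesis using assms by (induction bs) auto
qed

lemma count_list_filter_eq: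
  "P a \<Longrightarrow> count_list (filter P xs) a = count_list xs a"
  by (induction xs) auto

lemma finite_F_sizes:
  assumes "1 \<le> r" "s \<le> k"
  shows "finite (F_sizes r s k m)"
proof -
  have "card (set xs) \<le> 2 ^ m * r"
    if blocks: "on_blocks m xs" and av: "avoids_formations r s xs"
      and cnt: "\<forall>a\<in>set xs. k \<le> count_list xs a" for xs :: "nat list"
  proof -
    obtain bs where bs: "length bs = m" "\<forall>b\<in>set bs. distinct b" "xs = concat bs"
      using blocks by (auto simp: on_blocks_def)
    define g where "g a = {b \<in> set bs. a \<in> set b}" for a
    have fibre: "card {a \<in> set xs. g a = B} \<le> r" for B
    proof (rule ccontr)
      assume "\<not> ?thesis"
      then obtain R where R: "R \<subseteq> {a \<in> set xs. g a = B}" "card R = r" "finite R"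
        by (metis (no_types, lifting) nle_le obtain_subset_with_card_n)
      have "R \<noteq> {}" using R assms by auto
      then obtain a where a: "a \<in> R" by auto
      define qs where "qs = filter (\<lambda>q. q \<noteq> []) (map (filter (\<lambda>x. x \<in> R)) bs)"
      have perm: "distinct q \<and> set q = R" if "q \<in> set qs" for q
      proof -
        have "\<exists>b\<in>set bs. q = filter (\<lambda>x. x \<in> R) b \<and> q \<noteq> []"
          using that unfolding qs_def set_filter set_map by blast
        then obtain b where b: "b \<in> set bs" "q = filter (\<lambda>x. x \<in> R) b" "q \<noteq> []"
          by blast
        then obtain c where "c \<in> R" "c \<in> set b" by (metis filter_False)
        then have "b \<in> B" using R b by (auto simp: g_def)
        then have "R \<subseteq> set b" using R by (auto simp: g_def)
        then show ?thesis using b bs by auto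
      qed
      have cat: "concat qs = filter (\<lambda>x. x \<in> R) xs"
        unfolding qs_def bs(3) by (induction bs) auto
      have "count_list xs a = length qs"
        using count_list_concat_distinct[of qs a] perm a count_list_filter_eq[of "\<lambda>x. x \<in> R" a xs]
        by (simp add: cat)
      with cnt a R assms have len: "s \<le> length qs" by (metis (no_types, lifting) le_trans mem_Collect_eq subsetD)
      have "concat qs = concat (take s qs) @ concat (drop s qs)"
        by (metis append_take_drop_id concat_append)
      then have "subseq (concat (take s qs)) (filter (\<lambda>x. x \<in> R) xs)"
        by (metis cat prefixI prefix_imp_subseq)
      then have "subseq (concat (take s qs)) xs"
        by (rule subseq_order.order_trans) (rule subseq_filter_left)
      moreover have "formation r s (concat (take s qs))"
        unfolding formation_def
        by (rule exI[of _ R], rule exI[of _ "take s qs"])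
          (use R len perm in \<open>auto simp: permutations_of_set_def dest: in_set_takeD\<close>)
      ultimately show False using av by (auto simp: avoids_formations_def)
    qed
    have "g a \<in> Pow (set bs)" for a by (auto simp: g_def)
    then have "set xs = (\<Union>B\<in>Pow (set bs). {a \<in> set xs. g a = B})" by blast
    then have "card (set xs) \<le> (\<Sum>B\<in>Pow (set bs). card {a \<in> set xs. g a = B})"
      using card_UN_le[of "Pow (set bs)" "\<lambda>B. {a \<in> set xs. g a = B}"] by simp
    also have "\<dots> \<le> card (Pow (set bs)) * r"
      using sum_bounded_above[of "Pow (set bs)" "\<lambda>B. card {a \<in> set xs. g a = B}" r] fibre by simp
    also have "\<dots> \<le> 2 ^ m * r"
      using bs(1) card_length[of bs] by (simp add: card_Pow)
    finally show ?thesis .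
  qed
  then have "F_sizes r s k m \<subseteq> {..2 ^ m * r}" by (auto simp: F_sizes_def)
  then show ?thesis using finite_subset by blast
qed

lemma eta_sizes_nonempty:
  assumes "1 \<le> r"
  shows "0 \<in> eta_sizes r s k m"
  using assms unfolding eta_sizes_def by (auto intro!: exI[of _ "{#}"])

lemma chain_endpoints_mono:
  fixes a :: "nat \<Rightarrow> int"
  assumes "\<forall>i\<in>{1..<k}. a i < a (Suc i)" "1 \<le> i" "i < j" "j \<le> k"
  shows "a i < a j"
  using assms(3,4)
proof (induction j)
  case (Suc j)
  have "a j < a (Suc j)" if "i \<le> j" using assms(1,2) Suc.prems that by auto
  with Suc show ?case by (cases "i = j") auto
qed simp

lemma chain_endpoints_bounds:
  fixes a :: "nat \<Rightarrow> int"
  assumes "1 \<le> a 0" "a 0 \<le> a 1" "\<forall>i\<in>{1..<k}. a i < a (Suc i)" "a k \<le> int m" "i \<le> k" "1 \<le> k"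
  shows "1 \<le> a i" "a i \<le> int m"
proof -
  have lo: "a 0 \<le> a j" if "j \<le> k" for j
    using chain_endpoints_mono[OF assms(3), of 1 j] that assms(2)
    by (cases "j = 0"; cases "j = 1") auto
  show "1 \<le> a i" using lo[of i] assms by linarith
  show "a i \<le> int m"
    using chain_endpoints_mono[OF assms(3), of i k] lo[of k] assms
    by (cases "i = 0"; cases "i = k") auto
qed

lemma chain_stabbed:
  assumes "is_chain k m C" "s \<le> k"
  shows "\<exists>T. finite T \<and> card T = s \<and> stabs T C"
proof -
  obtain a :: "nat \<Rightarrow> int" where a: "a 0 \<le> a 1" "\<forall>i\<in>{1..<k}. a i < a (Suc i)"
    "C = map (\<lambda>i. if i = 0 then {a 0..a 1} else {a i + 1..a (Suc i)}) [0..<k]"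
    using assms by (auto simp: is_chain_def)
  define h where "h i = a (Suc i)" for i
  have inj: "inj_on h {..<s}"
  proof (rule linorder_inj_onI)
    fix i j assume "i < j" "i \<in> {..<s}" "j \<in> {..<s}"
    then show "h i \<noteq> h j"
      using chain_endpoints_mono[OF a(2), of "Suc i" "Suc j"] assms(2) by (auto simp: h_def)
  qed auto
  have "stabs (h ` {..<s}) C"
    unfolding stabs_def
  proof (intro exI conjI ballI)
    show "inj_on (inv_into {..<s} h) (h ` {..<s})" by (rule inj_on_inv_into) simp
  next
    fix t assume "t \<in> h ` {..<s}"
    then obtain i where i: "i < s" "t = h i" by auto
    then have inv: "inv_into {..<s} h t = i" using inj by simp
    have step: "i = 0 \<or> a i + 1 \<le> a (Suc i)"
      using i assms(2) bspec[OF a(2), of i] by (cases "i = 0") auto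
    have "i < length C" using i a assms(2) by simp
    moreover have "t \<in> C ! i" using i a(1,3) assms(2) step by (cases "i = 0") (auto simp: h_def)
    ultimately show "inv_into {..<s} h t < length C" "t \<in> C ! inv_into {..<s} h t"
      by (simp_all add: inv)
  qed
  then show ?thesis using inj by (intro exI[of _ "h ` {..<s}"]) (auto simp: card_image)
qed

lemma finite_chains:
  assumes "1 \<le> k"
  shows "finite {C. is_chain k m C}"
proof (rule finite_subset)
  show "{C. is_chain k m C} \<subseteq> {C. set C \<subseteq> Pow {1..int m} \<and> length C = k}"
  proof safe
    fix C S x assume "is_chain k m C" "S \<in> set C" "x \<in> S"
    then obtain a :: "nat \<Rightarrow> int" and i where a: "1 \<le> a 0" "a 0 \<le> a 1"
      "\<forall>i\<in>{1..<k}. a i < a (Suc i)" "a k \<le> int m"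
      and i: "i < k" "x \<in> (if i = 0 then {a 0..a 1} else {a i + 1..a (Suc i)})"
      by (auto simp: is_chain_def simp del: upt_Suc)
    then show "x \<in> {1..int m}"
      using chain_endpoints_bounds[OF a, of i] chain_endpoints_bounds[OF a, of "Suc i"] assms
      by (auto split: if_splits)
  qed (auto simp: is_chain_def)
  show "finite {C. set C \<subseteq> Pow {1..int m} \<and> length C = k}"
    by (rule finite_lists_length_eq) simp
qed

lemma finite_eta_sizes:
  assumes "1 \<le> k" "s \<le> k"
  shows "finite (eta_sizes r s k m)"
proof -
  have "size X \<le> card {C. is_chain k m C} * r"
    if X: "\<forall>C\<in>#X. is_chain k m C"
      and no: "\<not> (\<exists>Y T. Y \<subseteq># X \<and> size Y = r \<and> finite T \<and> card T = s \<and> (\<forall>C\<in>#Y. stabs T C))"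
    for X :: "int set list multiset"
  proof -
    have le: "count X C \<le> r" if C: "C \<in># X" for C
    proof (rule ccontr)
      assume "\<not> ?thesis"
      then have sub: "replicate_mset r C \<subseteq># X" by (simp add: count_le_replicate_mset_subset_eq[symmetric])
      obtain T where T: "finite T" "card T = s" "stabs T C"
        using chain_stabbed[of k m C s] X C assms(2) by auto
      have "\<forall>D\<in>#replicate_mset r C. stabs T D" using T(3) by simp
      with no sub T(1,2) show False by (metis size_replicate_mset)
    qed
    have "size X \<le> card (set_mset X) * r"
      using sum_bounded_above[of "set_mset X" "count X" r] le
      by (simp add: size_multiset_overloaded_eq)
    also have "\<dots> \<le> card {C. is_chain k m C} * r"
      using X finite_chains[OF assms(1)] by (intro mult_right_mono card_mono) auto
    finally show ?thesis .
  qed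
  then have "eta_sizes r s k m \<subseteq> {..card {C. is_chain k m C} * r}" by (auto simp: eta_sizes_def)
  then show ?thesis using finite_subset by blast
qed

end

theory Submission
  imports Defs
begin

text \<open>
  A letter occurring in the blocks \<open>c 0 < \<dots> < c k\<close> (counted from \<open>0\<close>) corresponds to the chain with
  intervals \<open>[c i + 1, c (i + 1)]\<close>. An \<open>s\<close>-tuple cuts the row of blocks into \<open>s + 1\<close> groups, and it
  stabs the chain iff the letter occurs in every group. So \<open>r\<close> chains stabbed by one tuple yield a
  formation, one permutation per group. Conversely, order the letters inside each block by decreasing
  previous occurrence. Then the leftmost formation on a set \<open>A\<close> of letters never uses one block
  for two permutations: a letter of \<open>A\<close> that completes a permutation is preceded, in its block, by all
  letters of \<open>A\<close> that already occurred for this permutation. Hence the blocks in which the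
  permutations are completed give a tuple stabbing all \<open>r\<close> chains.
\<close>

section \<open>Chains and letters encoded by numbers of blocks\<close>

text \<open>In the notation of \<^const>\<open>is_chain\<close>, \<open>a 0 = c 0 + 1\<close> and \<open>a i = c i\<close> for \<open>i > 0\<close>.\<close>

definition chain_of :: "nat \<Rightarrow> (nat \<Rightarrow> nat) \<Rightarrow> int set list" where
  "chain_of k c = map (\<lambda>i. {int (c i) + 1..int (c (Suc i))}) [0..<k]"

definition occs :: "'a list list \<Rightarrow> 'a \<Rightarrow> nat set" where
  "occs bs x = {i. i < length bs \<and> x \<in> set (bs ! i)}"

text \<open>The values \<open>u 0, ..., u n\<close> are cut points; group \<open>j\<close> consists
  of the blocks \<open>u j, ..., u (Suc j) - 1\<close>. Monotonicity of \<open>u\<close> on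
  \<open>{..n}\<close> comes for free, since an empty group cannot be hit.\<close>

definition hits :: "nat \<Rightarrow> (nat \<Rightarrow> nat) \<Rightarrow> nat set \<Rightarrow> bool" where
  "hits n u B \<longleftrightarrow> (\<forall>j<n. B \<inter> {u j..<u (Suc j)} \<noteq> {})"

lemma hitsD: "hits n u B \<Longrightarrow> j < n \<Longrightarrow> \<exists>b\<in>B. u j \<le> b \<and> b < u (Suc j)"
  unfolding hits_def by fastforce

lemma hits_mono: "hits n u B \<Longrightarrow> B \<subseteq> B' \<Longrightarrow> hits n u B'"
  unfolding hits_def by blast

lemma hits_strict_mono_on:
  assumes "hits n u B"
  shows "strict_mono_on {..n} u"
proof -
  have step: "u j < u (Suc j)" if "j < n" for j
    using assms that unfolding hits_def by fastforce
  have "i < j \<Longrightarrow> j \<le> n \<Longrightarrow> u i < u j" for i j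
  proof (induction j)
    case (Suc j)
    then show ?case using step[of j] by (cases "i = j") auto
  qed simp
  then show ?thesis by (auto simp: strict_mono_on_def)
qed

lemma is_chain_chain_of:
  assumes "1 \<le> k" "strict_mono_on {..k} c" "c k \<le> m"
  shows "is_chain k m (chain_of k c)"
  unfolding is_chain_def
proof (rule exI[of _ "\<lambda>i. if i = 0 then int (c 0) + 1 else int (c i)"], intro conjI)
  let ?a = "\<lambda>i. if i = 0 then int (c 0) + 1 else int (c i)"
  show "1 \<le> ?a 0" by simp
  show "?a 0 \<le> ?a 1" using strict_mono_onD[OF assms(2), of 0 1] assms(1) by simp
  show "\<forall>i\<in>{1..<k}. ?a i < ?a (Suc i)"
    using strict_mono_onD[OF assms(2)] by auto
  show "?a k \<le> int m" using assms by simp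
  show "chain_of k c = map (\<lambda>i. if i = 0 then {?a 0..?a 1} else {?a i + 1..?a (Suc i)}) [0..<k]"
    by (simp add: chain_of_def)
qed

lemma is_chainE:
  assumes "is_chain k m C" "1 \<le> k"
  obtains c where "strict_mono_on {..k} c" "c k \<le> m" "C = chain_of k c"
proof -
  obtain a :: "nat \<Rightarrow> int" where a: "1 \<le> a 0" "a 0 \<le> a 1" "\<forall>i\<in>{1..<k}. a i < a (Suc i)"
    "a k \<le> int m" "C = map (\<lambda>i. if i = 0 then {a 0..a 1} else {a i + 1..a (Suc i)}) [0..<k]"
    using assms by (auto simp: is_chain_def)
  note bounds = chain_endpoints_bounds[OF a(1-4) _ assms(2)]
  \<comment> \<open>\<open>nat\<close> truncates nothing at indices up to \<open>k\<close>, since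
    there \<open>a i\<close> is at least 1. The shift at index 0 gives the first interval the same
    half-open form as the others.\<close>
  define c where "c i = nat (if i = 0 then a 0 - 1 else a i)" for i
  have int_c: "int (c i) = (if i = 0 then a 0 - 1 else a i)" if "i \<le> k" for i
    using bounds(1)[OF that] a(1) by (auto simp: c_def)
  have "strict_mono_on {..k} c"
  proof (rule strict_mono_onI)
    fix i j assume ij: "i \<in> {..k}" "j \<in> {..k}" "i < j"
    have "a 1 \<le> a j" using chain_endpoints_mono[OF a(3), of 1 j] ij by (cases "j = 1") auto
    then have "int (c i) < int (c j)"
      using int_c[of i] int_c[of j] chain_endpoints_mono[OF a(3), of i j] ij a(2) by auto
    then show "c i < c j" by simp
  qed
  moreover have "c k \<le> m" using int_c[of k] a(4) assms(2) by simp
  moreover have "C = chain_of k c"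
    unfolding a(5) chain_of_def using int_c by (intro map_cong) auto
  ultimately show thesis using that by blast
qed

section \<open>Stabbing tuples as partitions of the row of blocks\<close>

text \<open>The elements of \<open>T\<close> serve as interior cut points. As \<open>u\<close> is
  obtained before \<open>c\<close>, one partition serves all chains stabbed by
  \<open>T\<close>.\<close>

lemma stabs_chain_of_imp_hits:
  assumes "finite T" "card T = s" "1 \<le> s"
  obtains u where "\<And>c. strict_mono_on {..k} c \<Longrightarrow> c k \<le> m \<Longrightarrow> stabs T (chain_of k c) \<Longrightarrow>
    hits (Suc s) u (c ` {..k})"
proof -
  define ts where "ts = sorted_list_of_set T"
  have ts: "length ts = s" "set ts = T" "sorted_wrt (<) ts"
    using assms by (auto simp: ts_def)
  \<comment> \<open>The outer cut points 0 and \<open>Suc m\<close> enclose all block numbers.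
    \<open>nat\<close> does no harm, because the elements of a tuple stabbing some
    \<open>chain_of k c\<close> are positive.\<close>
  define u where "u j = (if j = 0 then 0 else if j \<le> s then nat (ts ! (j - 1)) else Suc m)" for j
  show thesis
  proof (rule that)
    fix c assume c: "strict_mono_on {..k} c" "c k \<le> m" and "stabs T (chain_of k c)"
    then obtain f where f: "inj_on f T" "\<And>t. t \<in> T \<Longrightarrow> f t < k"
      "\<And>t. t \<in> T \<Longrightarrow> int (c (f t)) < t" "\<And>t. t \<in> T \<Longrightarrow> t \<le> int (c (Suc (f t)))"
      unfolding stabs_def chain_of_def by (fastforce)
    have c_le: "c i \<le> c j" if "i \<le> j" "j \<le> k" for i j
      using strict_mono_onD[OF c(1), of i j] that by (cases "i = j") auto
    have f_less: "f t < f t'" if "t \<in> T" "t' \<in> T" "t < t'" for t t'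
    proof (rule ccontr)
      assume "\<not> f t < f t'"
      moreover have "f t \<noteq> f t'" using f(1) that by (auto dest: inj_onD)
      ultimately have "Suc (f t') \<le> f t" by simp
      then have "c (Suc (f t')) \<le> c (f t)" using f(2)[OF that(1)] by (intro c_le) auto
      then show False using f(3)[OF that(1)] f(4)[OF that(2)] that(3) by linarith
    qed
    have ts_in: "ts ! i \<in> T" if "i < s" for i using that ts nth_mem by blast
    \<comment> \<open>Group 0 is hit by the value of \<open>c\<close> just before the interval of
      the smallest element, group \<open>Suc i\<close> by the right end of the interval of
      \<open>ts ! i\<close>. This end stays below the next element, which lies in a later
      interval.\<close>
    have "c ` {..k} \<inter> {u j..<u (Suc j)} \<noteq> {}" if "j < Suc s" for j
    proof (cases j)
      case 0
      have "c (f (ts ! 0)) \<in> {u j..<u (Suc j)}"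
        using 0 assms(3) f(3)[OF ts_in[of 0]] by (auto simp: u_def)
      moreover have "f (ts ! 0) \<le> k" using f(2)[OF ts_in[of 0]] assms(3) by simp
      ultimately show ?thesis by blast
    next
      case (Suc i)
      then have i: "i < s" using that by simp
      let ?q = "Suc (f (ts ! i))"
      have q: "?q \<le> k" using f(2)[OF ts_in[OF i]] by simp
      have lo: "u j \<le> c ?q" using f(4)[OF ts_in[OF i]] i Suc by (simp add: u_def)
      have "c ?q < u (Suc j)"
      proof (cases "Suc i < s")
        case True
        have "ts ! i < ts ! Suc i" using ts True by (auto intro: sorted_wrt_nth_less)
        then have "?q \<le> f (ts ! Suc i)" using f_less ts_in i True by (simp add: Suc_le_eq)
        then have "c ?q \<le> c (f (ts ! Suc i))" using f(2)[OF ts_in[OF True]] by (intro c_le) auto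
        then show ?thesis using f(3)[OF ts_in[OF True]] True Suc by (simp add: u_def)
      next
        case False
        then show ?thesis using c_le[OF q] c(2) Suc by (simp add: u_def)
      qed
      with lo q show ?thesis by (auto simp: disjoint_iff)
    qed
    then show "hits (Suc s) u (c ` {..k})" by (simp add: hits_def)
  qed
qed

text \<open>Each interior cut point has a value of \<open>c\<close> below it and one at or above it,
  so it lies in an interval. Any two are separated by a value of \<open>c\<close>, so their
  intervals differ.\<close>

lemma hits_imp_stabs_chain_of:
  assumes c: "strict_mono_on {..k} c" and h: "hits (Suc s) u (c ` {..k})"
  shows "stabs (int ` u ` {1..s}) (chain_of k c)"
proof -
  have u: "strict_mono_on {..Suc s} u" by (rule hits_strict_mono_on[OF h])
  have hit: "\<exists>p\<le>k. u j \<le> c p \<and> c p < u (Suc j)" if "j \<le> s" for j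
    using hitsD[OF h, of j] that by auto
  have ex: "\<exists>i<k. c i < u j \<and> u j \<le> c (Suc i)" if j: "j \<in> {1..s}" for j
  proof -
    obtain j' where "j = Suc j'" "j' \<le> s" using j by (cases j) auto
    then obtain p where p: "p \<le> k" "c p < u j" using hit by blast
    obtain q where q: "q \<le> k" "u j \<le> c q" using hit[of j] j by auto
    \<comment> \<open>This index is positive because \<open>c p < u j\<close>; its predecessor is
      the number of the interval containing \<open>u j\<close>.\<close>
    define l where "l = (LEAST l. u j \<le> c l)"
    have l: "u j \<le> c l" "l \<le> q" unfolding l_def using q by (auto intro: LeastI Least_le)
    have "c 0 \<le> c p" using strict_mono_onD[OF c, of 0 p] p by (cases "p = 0") auto
    then obtain i where i: "l = Suc i" using l(1) p by (cases l) auto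
    then have "c i < u j" unfolding l_def using not_less_Least[of i "\<lambda>l. u j \<le> c l"] by auto
    then show ?thesis using l i q by (intro exI[of _ i]) auto
  qed
  then obtain g where g: "\<And>j. j \<in> {1..s} \<Longrightarrow> g j < k \<and> c (g j) < u j \<and> u j \<le> c (Suc (g j))"
    by metis
  have "g j \<noteq> g j'" if jj: "j \<in> {1..s}" "j' \<in> {1..s}" "j < j'" for j j'
  proof
    assume eq: "g j = g j'"
    obtain p where p: "p \<le> k" "u j \<le> c p" "c p < u (Suc j)" using hit[of j] jj by auto
    have "u (Suc j) \<le> u j'"
      using strict_mono_onD[OF u, of "Suc j" j'] jj by (cases "Suc j = j'") auto
    then have "c (g j) < c p" "c p < c (Suc (g j))" using g[OF jj(1)] g[OF jj(2)] p eq by auto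
    then have "g j < p" "p < Suc (g j)"
      using strict_mono_on_less[OF c, of "g j" p] strict_mono_on_less[OF c, of p "Suc (g j)"]
        p g[OF jj(1)] by auto
    then show False by simp
  qed
  then have inj: "inj_on g {1..s}" by (intro linorder_inj_onI) auto
  \<comment> \<open>\<open>w\<close> recovers \<open>j\<close> from \<open>int (u j)\<close>, so
    \<open>g \<circ> w\<close> assigns to each element of the tuple its interval.\<close>
  define w where "w = inv_into {1..s} u \<circ> nat"
  have inj_u: "inj_on u {1..s}"
    using strict_mono_on_imp_inj_on[OF u] by (rule inj_on_subset) auto
  have w: "w (int (u j)) = j" if "j \<in> {1..s}" for j
    using inj_u that unfolding w_def by simp
  show ?thesis unfolding stabs_def
  proof (intro exI conjI ballI)
    have "w ` int ` u ` {1..s} = {1..s}" using w by (force simp: image_iff)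
    moreover have "inj_on w (int ` u ` {1..s})"
      by (rule inj_on_inverseI[of _ "\<lambda>j. int (u j)"]) (auto simp: w)
    ultimately show "inj_on (g \<circ> w) (int ` u ` {1..s})"
      using inj by (metis comp_inj_on)
  next
    fix t assume "t \<in> int ` u ` {1..s}"
    then obtain j where j: "j \<in> {1..s}" "t = int (u j)" by blast
    show "(g \<circ> w) t < length (chain_of k c)" "t \<in> chain_of k c ! (g \<circ> w) t"
      using g[OF j(1)] w[OF j(1)] j(2) by (auto simp: chain_of_def)
  qed
qed

section \<open>From a common partition to a formation\<close>

lemma count_list_distinct:
  "distinct xs \<Longrightarrow> count_list xs a = (if a \<in> set xs then 1 else 0)"
  by (induction xs) auto

text \<open>A block contains a letter at most once, so occurrences can be counted by blocks.\<close>

lemma count_list_concat_eq_card_occs: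
  assumes "\<forall>b\<in>set bs. distinct b"
  shows "count_list (concat bs) x = card (occs bs x)"
  using assms
proof (induction bs rule: rev_induct)
  case (snoc b bs)
  have "occs (bs @ [b]) x = (if x \<in> set b then insert (length bs) (occs bs x) else occs bs x)"
    by (auto simp: occs_def nth_append less_Suc_eq)
  moreover have "finite (occs bs x)" "length bs \<notin> occs bs x" by (auto simp: occs_def)
  ultimately show ?case using snoc by (simp add: count_list_distinct)
qed (simp add: occs_def)

lemma subseq_remdups: "subseq (remdups xs) xs"
  by (induction xs) auto

lemma subset_set_imp_subseq_permutation:
  assumes "A \<subseteq> set xs"
  obtains p where "subseq p xs" "p \<in> permutations_of_set A"
proof -
  let ?p = "remdups (filter (\<lambda>x. x \<in> A) xs)"
  have "subseq ?p xs"
    using subseq_remdups subseq_filter_left by (rule subseq_order.order_trans)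
  moreover have "?p \<in> permutations_of_set A" using assms by (auto simp: permutations_of_set_def)
  ultimately show thesis using that by blast
qed

text \<open>Every group contains all of \<open>A\<close>, hence a permutation of \<open>A\<close> as
  a subsequence. The induction collects these permutations group by group from the left.\<close>

lemma hits_occs_imp_formation:
  assumes "finite A" "A \<noteq> {}" "\<And>x. x \<in> A \<Longrightarrow> hits n u (occs bs x)"
  shows "\<exists>ys. subseq ys (concat bs) \<and> formation (card A) n ys"
proof -
  obtain x0 where "x0 \<in> A" using assms(2) by auto
  then have u: "strict_mono_on {..n} u" using assms(3) hits_strict_mono_on by blast
  have "\<exists>ps. length ps = j \<and> (\<forall>p\<in>set ps. p \<in> permutations_of_set A) \<and>
      subseq (concat ps) (concat (take (u j) bs))" if "j \<le> n" for j
    using that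
  proof (induction j)
    case (Suc j)
    then obtain ps where ps: "length ps = j" "\<forall>p\<in>set ps. p \<in> permutations_of_set A"
      "subseq (concat ps) (concat (take (u j) bs))" by auto
    have less: "u j < u (Suc j)" using strict_mono_onD[OF u] Suc.prems by simp
    let ?g = "take (u (Suc j) - u j) (drop (u j) bs)"
    have split: "take (u (Suc j)) bs = take (u j) bs @ ?g"
      using less by (metis le_add_diff_inverse less_imp_le take_add)
    have "A \<subseteq> set (concat ?g)"
    proof
      fix x assume "x \<in> A"
      then obtain i where i: "i < length bs" "x \<in> set (bs ! i)" "u j \<le> i" "i < u (Suc j)"
        using hitsD[OF assms(3), of x j] Suc.prems by (auto simp: occs_def)
      then have "?g ! (i - u j) = bs ! i" "i - u j < length ?g" by auto
      then show "x \<in> set (concat ?g)" using i(2) nth_mem[of "i - u j" ?g] by auto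
    qed
    then obtain p where p: "subseq p (concat ?g)" "p \<in> permutations_of_set A"
      by (rule subset_set_imp_subseq_permutation)
    have "subseq (concat (ps @ [p])) (concat (take (u (Suc j)) bs))"
      unfolding split using ps p by (simp add: list_emb_append_mono)
    then show ?case using ps p by (intro exI[of _ "ps @ [p]"]) auto
  qed simp
  then obtain ps where ps: "length ps = n" "\<forall>p\<in>set ps. p \<in> permutations_of_set A"
    "subseq (concat ps) (concat (take (u n) bs))" by blast
  have "concat bs = concat (take (u n) bs) @ concat (drop (u n) bs)"
    by (metis append_take_drop_id concat_append)
  then have "subseq (concat ps) (concat bs)" using ps(3) by (metis list_emb_append2 list_emb_prefix)
  moreover have "formation (card A) n (concat ps)"
    unfolding formation_def using assms(1) ps by blast
  ultimately show ?thesis by blast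
qed

section \<open>From a formation in recency-ordered blocks to a partition\<close>

lemma subseq_append_disjoint:
  "subseq q (xs @ ys) \<Longrightarrow> set q \<inter> set xs = {} \<Longrightarrow> subseq q ys"
proof (induction xs)
  case (Cons x xs)
  then show ?case by (cases q) auto
qed simp

text \<open>Decreasing previous occurrence, stated without maxima: if \<open>y\<close> stands before
  \<open>z\<close> in block \<open>j\<close>, then each earlier occurrence of \<open>z\<close> is
  matched by one of \<open>y\<close> that is no earlier and still before \<open>j\<close>. Ties may
  be broken either way, and a letter without previous occurrence may follow any other.\<close>

definition recency_ordered :: "'a list list \<Rightarrow> bool" where
  "recency_ordered bs \<longleftrightarrow> (\<forall>j<length bs. sorted_wrt (\<lambda>y z. \<forall>i\<in>occs bs z. i < j \<longrightarrow>
     (\<exists>i'\<in>occs bs y. i \<le> i' \<and> i' < j)) (bs ! j))"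

text \<open>The greedy step: \<open>v'\<close> is the end of the shortest run of blocks from \<open>v\<close> on that contains all of
  \<open>A\<close>. Behind the first permutation, the last block of this run has no letter of \<open>A\<close> left, so the
  remaining permutations start at \<open>v'\<close> or later.\<close>

lemma recency_ordered_formation_step:
  assumes dist: "\<forall>b\<in>set bs. distinct b" and ord: "recency_ordered bs"
    and A: "A \<noteq> {}" "set p = A" "set q \<subseteq> A"
    and sub: "subseq (p @ q) (concat (drop v bs))"
  obtains v' where "\<And>x. x \<in> A \<Longrightarrow> occs bs x \<inter> {v..<v'} \<noteq> {}" "subseq q (concat (drop v' bs))"
proof -
  obtain us vs where usvs: "concat (drop v bs) = us @ vs" "subseq p us" "subseq q vs"
    using list_emb_appendD[OF sub] by blast
  have A_us: "A \<subseteq> set us" using usvs(2) A(2) by (auto elim: list_emb_set)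
  let ?zs = "drop v bs"
  define P where "P n \<longleftrightarrow> A \<subseteq> set (concat (take n ?zs))" for n
  have "A \<subseteq> set (concat ?zs)" using A_us usvs(1) by (metis le_supI1 set_append)
  then have "P (length ?zs)" unfolding P_def by simp
  then have P: "P (LEAST n. P n)" by (rule LeastI)
  have "\<not> P 0" using A(1) by (auto simp: P_def)
  then obtain l where l: "(LEAST n. P n) = Suc l" using P by (metis not0_implies_Suc)
  then have nP: "\<not> P l" using not_less_Least[of l P] by simp
  have len: "l < length ?zs" using P nP l unfolding P_def by (metis Suc_leI not_less take_all le_Suc_eq)
  let ?w = "v + l"
  have w: "?w < length bs" "?zs ! l = bs ! ?w" using len by auto
  let ?L = "concat (take l ?zs)" and ?M = "concat (drop (Suc ?w) bs)"
  \<comment> \<open>\<open>?w\<close> is the block in which \<open>A\<close> is completed, and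
    \<open>x0\<close> is a letter that the run from \<open>v\<close> on still lacks before
    \<open>?w\<close>.\<close>
  obtain x0 where x0: "x0 \<in> A" "x0 \<notin> set ?L" using nP by (auto simp: P_def)
  have split: "concat ?zs = ?L @ bs ! ?w @ ?M"
  proof -
    have "?zs = take l ?zs @ ?zs ! l # drop (Suc l) ?zs" using len by (rule id_take_nth_drop)
    then have "concat ?zs = concat (take l ?zs @ ?zs ! l # drop (Suc l) ?zs)" by simp
    then show ?thesis using w(2) by (simp add: add.commute)
  qed
  have in_L: "x \<in> set ?L \<longleftrightarrow> occs bs x \<inter> {v..<?w} \<noteq> {}" for x
  proof
    assume "x \<in> set ?L"
    then obtain b where "b \<in> set (take l ?zs)" "x \<in> set b" by auto
    then obtain i where "i < l" "x \<in> set (?zs ! i)" "i < length ?zs"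
      by (fastforce simp: in_set_conv_nth[of b])
    then have "v + i \<in> occs bs x \<inter> {v..<?w}" by (auto simp: occs_def)
    then show "occs bs x \<inter> {v..<?w} \<noteq> {}" by blast
  next
    assume "occs bs x \<inter> {v..<?w} \<noteq> {}"
    then obtain i where i: "v \<le> i" "i < ?w" "i < length bs" "x \<in> set (bs ! i)"
      by (auto simp: occs_def)
    then have "take l ?zs ! (i - v) = bs ! i" "i - v < length (take l ?zs)" by auto
    then show "x \<in> set ?L" using i(4) nth_mem[of "i - v" "take l ?zs"] by auto
  qed
  have occ: "occs bs x \<inter> {v..<Suc ?w} \<noteq> {}" if "x \<in> A" for x
  proof -
    have "x \<in> set (concat (take (Suc l) ?zs))" using P l that by (auto simp: P_def)
    then have "x \<in> set ?L \<or> x \<in> set (bs ! ?w)"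
      using len w by (simp add: take_Suc_conv_app_nth)
    then show ?thesis
    proof
      assume "x \<in> set ?L"
      then show ?thesis using in_L[of x] by (auto simp: disjoint_iff)
    next
      assume "x \<in> set (bs ! ?w)"
      then have "?w \<in> occs bs x \<inter> {v..<Suc ?w}" using w by (auto simp: occs_def)
      then show ?thesis by blast
    qed
  qed
  \<comment> \<open>Since \<open>x0\<close> occurs in \<open>us\<close> but not in
    \<open>?L\<close>, the part \<open>us\<close> holding the first permutation reaches into block
    \<open>?w\<close>. It either covers this block or leaves a \<open>rest\<close> of it.\<close>
  have x0_us: "x0 \<in> set us" using x0 A_us by auto
  have "us @ vs = ?L @ bs ! ?w @ ?M" using usvs(1) split by simp
  from this[THEN append_eq_append_conv2[THEN iffD1]] obtain e where
    "us = ?L @ e \<and> e @ vs = bs ! ?w @ ?M \<or> us @ e = ?L \<and> vs = e @ bs ! ?w @ ?M" ..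
  moreover have "us @ e \<noteq> ?L" using x0(2) x0_us by (metis Un_iff set_append)
  ultimately obtain us' where us': "us = ?L @ us'" "us' @ vs = bs ! ?w @ ?M" by blast
  have x0_us': "x0 \<in> set us'" using x0 x0_us us'(1) by simp
  from us'(2)[THEN append_eq_append_conv2[THEN iffD1]] obtain e where
    "us' = bs ! ?w @ e \<and> e @ vs = ?M \<or> us' @ e = bs ! ?w \<and> vs = e @ ?M" ..
  then consider "?M = e @ vs" | rest where "bs ! ?w = us' @ rest" "vs = rest @ ?M"
    by metis
  then have "subseq q ?M"
  proof cases
    case 1
    then show ?thesis using usvs(3) by (simp add: list_emb_append2)
  next
    case rest: 2
    \<comment> \<open>Such a \<open>z\<close> also occurs in \<open>us\<close>, and by distinctness
      of the block it does so in \<open>?L\<close>. As \<open>x0\<close> precedes \<open>z\<close>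
      in block \<open>?w\<close>, the recency order would put \<open>x0\<close> into
      \<open>?L\<close> as well.\<close>
    have "z \<notin> set rest" if "z \<in> A" for z
    proof
      assume z: "z \<in> set rest"
      have "distinct (us' @ rest)" using dist w rest(1) nth_mem by metis
      then have "z \<in> set ?L" using that z A_us us'(1) by auto
      then obtain i where i: "i \<in> occs bs z" "v \<le> i" "i < ?w" using in_L[of z] by auto
      have "\<forall>i\<in>occs bs z. i < ?w \<longrightarrow> (\<exists>i'\<in>occs bs x0. i \<le> i' \<and> i' < ?w)"
        using ord w(1) rest(1) x0_us' z unfolding recency_ordered_def
        by (fastforce simp: sorted_wrt_append)
      then have "x0 \<in> set ?L" using i in_L[of x0] by fastforce
      then show False using x0 by simp
    qed
    then have "set q \<inter> set rest = {}" using A(3) by auto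
    then show ?thesis using usvs(3) rest(2) subseq_append_disjoint by blast
  qed
  then show thesis using that[of "Suc ?w"] occ by blast
qed

text \<open>Iteration of the greedy step. The clause \<open>u 0 = v\<close> makes the cut points for
  the remaining permutations continue where the first group ends.\<close>

lemma recency_ordered_formation_imp_hits:
  assumes dist: "\<forall>b\<in>set bs. distinct b" and ord: "recency_ordered bs" and A: "A \<noteq> {}"
  shows "\<forall>p\<in>set ps. set p = A \<Longrightarrow> subseq (concat ps) (concat (drop v bs)) \<Longrightarrow>
    \<exists>u. u 0 = v \<and> (\<forall>x\<in>A. hits (length ps) u (occs bs x))"
proof (induction ps arbitrary: v)
  case Nil
  then show ?case by (auto simp: hits_def)
next
  case (Cons p ps)
  obtain v' where v': "\<And>x. x \<in> A \<Longrightarrow> occs bs x \<inter> {v..<v'} \<noteq> {}"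
    "subseq (concat ps) (concat (drop v' bs))"
    by (rule recency_ordered_formation_step[OF dist ord A, of p "concat ps" v])
      (use Cons.prems in auto)
  obtain u where u: "u 0 = v'" "\<forall>x\<in>A. hits (length ps) u (occs bs x)"
    using Cons.IH[OF _ v'(2)] Cons.prems(1) by auto
  \<comment> \<open>\<open>case_nat v u\<close> puts \<open>v\<close> in front of the cut points
    \<open>u\<close>, which begin with \<open>v'\<close>.\<close>
  have "hits (length (p # ps)) (case_nat v u) (occs bs x)" if "x \<in> A" for x
    unfolding hits_def
  proof (intro allI impI)
    fix j assume "j < length (p # ps)"
    then show "occs bs x \<inter> {case_nat v u j..<case_nat v u (Suc j)} \<noteq> {}"
      using v'(1)[OF that] u that by (cases j) (auto simp: hits_def)
  qed
  then show ?case by (intro exI[of _ "case_nat v u"]) auto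
qed

section \<open>Construction of recency-ordered blocks\<close>

lemma ex_recency_ordered:
  fixes B :: "'a :: linorder \<Rightarrow> nat set"
  assumes "finite A" "\<And>x. x \<in> A \<Longrightarrow> B x \<subseteq> {..<n}"
  obtains bs where "length bs = n" "\<forall>b\<in>set bs. distinct b" "recency_ordered bs"
    "\<And>x. occs bs x = (if x \<in> A then B x else {})"
proof -
  \<comment> \<open>One more than the last occurrence before \<open>j\<close>, or 0 if there is
    none. The minus sign in the sort key below makes the order decreasing.\<close>
  define pr where "pr j x = Max (insert 0 (Suc ` {i \<in> B x. i < j}))" for j x
  define bl where "bl j = sort_key (\<lambda>x. - int (pr j x)) (sorted_list_of_set {x \<in> A. j \<in> B x})" for j
  define bs where "bs = map bl [0..<n]"
  have fin: "finite {x \<in> A. j \<in> B x}" for j using assms(1) by simp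
  have occs: "occs bs x = (if x \<in> A then B x else {})" for x
  proof -
    have "occs bs x = {i. i < n \<and> x \<in> A \<and> i \<in> B x}"
      using fin by (auto simp: occs_def bs_def bl_def)
    then show ?thesis using assms(2) by auto
  qed
  have "recency_ordered bs"
    unfolding recency_ordered_def
  proof (intro allI impI)
    fix j assume j: "j < length bs"
    have "sorted_wrt (\<lambda>y z. - int (pr j y) \<le> - int (pr j z)) (bl j)"
      unfolding bl_def using sorted_sort_key[unfolded sorted_map] .
    moreover have "\<exists>i'\<in>occs bs y. i \<le> i' \<and> i' < j"
      if y: "y \<in> set (bl j)" and z: "z \<in> set (bl j)"
        and le: "- int (pr j y) \<le> - int (pr j z)" and i: "i \<in> occs bs z" "i < j" for y z i
    proof -
      have yz: "y \<in> A" "z \<in> A" using y z fin by (auto simp: bl_def)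
      have "Suc i \<le> pr j z" unfolding pr_def using i yz occs by (intro Max_ge) auto
      then have ge: "Suc i \<le> pr j y" using le by linarith
      have "pr j y \<in> insert 0 (Suc ` {i \<in> B y. i < j})" unfolding pr_def by (rule Max_in) auto
      then obtain i' where "pr j y = Suc i'" "i' \<in> B y" "i' < j" using ge by auto
      then show ?thesis using ge yz occs by auto
    qed
    ultimately show "sorted_wrt (\<lambda>y z. \<forall>i\<in>occs bs z. i < j \<longrightarrow>
        (\<exists>i'\<in>occs bs y. i \<le> i' \<and> i' < j)) (bs ! j)"
      using j by (auto simp: bs_def intro: sorted_wrt_mono_rel[rotated])
  qed
  moreover have "length bs = n" "\<forall>b\<in>set bs. distinct b" by (auto simp: bs_def bl_def)
  ultimately show thesis using that occs by blast
qed

section \<open>The two inclusions between the sets of sizes\<close>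

text \<open>The witness lists the \<open>Suc k\<close> smallest elements; for a letter with more
  occurrences, the surplus is dropped.\<close>

lemma ex_strict_mono_on_image_subset:
  assumes "finite B" "Suc k \<le> card B"
  shows "\<exists>c :: nat \<Rightarrow> nat. strict_mono_on {..k} c \<and> c ` {..k} \<subseteq> B"
proof (intro exI conjI)
  let ?c = "\<lambda>i. sorted_list_of_set B ! i"
  show "strict_mono_on {..k} ?c"
    using assms(2) by (auto intro!: strict_mono_onI sorted_wrt_nth_less[of "(<)"])
  show "?c ` {..k} \<subseteq> B"
  proof safe
    fix i assume "i \<le> k"
    then show "?c i \<in> B" using nth_mem[of i "sorted_list_of_set B"] assms by simp
  qed
qed

text \<open>Multiplicities in \<open>mset_set A\<close> are at most 1, so the preimage of
  \<open>Y\<close> is again a set. Thus \<open>r\<close> chains, counted with multiplicity, come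
  from \<open>r\<close> different letters.\<close>

lemma subset_image_mset_mset_setE:
  assumes "Y \<subseteq># image_mset g (mset_set A)" "finite A"
  obtains A' where "A' \<subseteq> A" "Y = image_mset g (mset_set A')"
proof -
  obtain D where "image_mset g (mset_set A) = Y + D"
    using assms(1) by (auto simp: subset_mset.le_iff_add)
  from image_mset_eq_plusD[OF this] obtain Z where Z: "Z \<subseteq># mset_set A" "Y = image_mset g Z"
    by (metis mset_subset_eq_add_left)
  have "Z = mset_set (set_mset Z)"
  proof (rule multiset_eqI)
    fix x
    have "count Z x \<le> count (mset_set A) x" using Z(1) by (rule mset_subset_eq_count)
    also have "\<dots> \<le> 1" by (simp add: count_mset_set')
    finally have "count Z x \<le> 1" .
    moreover have "count Z x \<noteq> 0 \<longleftrightarrow> x \<in># Z" by simp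
    ultimately show "count Z x = count (mset_set (set_mset Z)) x"
      unfolding count_mset_set' by (metis One_nat_def finite_set_mset le_Suc_eq le_zero_eq)
  qed
  moreover have "set_mset Z \<subseteq> A" using set_mset_mono[OF Z(1)] assms(2) by simp
  ultimately show thesis using that Z(2) by metis
qed

text \<open>Each letter yields the chain of some \<open>k + 1\<close> of its blocks. A tuple
  stabbing \<open>r\<close> of these chains would partition the blocks so that \<open>r\<close>
  letters occur in each of \<open>s + 1\<close> groups.\<close>

lemma F_sizes_subset_eta_sizes:
  assumes r: "1 \<le> r" and s: "1 \<le> s" and k: "1 \<le> k"
  shows "F_sizes r (s + 1) (k + 1) (m + 1) \<subseteq> eta_sizes r s k m"
proof
  fix n assume "n \<in> F_sizes r (s + 1) (k + 1) (m + 1)"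
  then obtain xs :: "nat list" where xs: "n = card (set xs)" "on_blocks (m + 1) xs"
    "avoids_formations r (s + 1) xs" "\<forall>a\<in>set xs. k + 1 \<le> count_list xs a"
    by (auto simp: F_sizes_def)
  then obtain bs where bs: "length bs = m + 1" "\<forall>b\<in>set bs. distinct b" "xs = concat bs"
    by (auto simp: on_blocks_def)
  have fin: "finite (occs bs x)" for x by (simp add: occs_def)
  have "\<forall>x\<in>set xs. \<exists>c. strict_mono_on {..k} c \<and> c ` {..k} \<subseteq> occs bs x"
    using xs(4) count_list_concat_eq_card_occs[OF bs(2)] bs(3) fin
    by (intro ballI ex_strict_mono_on_image_subset) auto
  then obtain c where c: "\<And>x. x \<in> set xs \<Longrightarrow> strict_mono_on {..k} (c x)"
    "\<And>x. x \<in> set xs \<Longrightarrow> c x ` {..k} \<subseteq> occs bs x" by metis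
  have ck: "c x k \<le> m" if "x \<in> set xs" for x
  proof -
    have "c x k \<in> occs bs x" using c(2)[OF that] by blast
    then show ?thesis using bs(1) by (simp add: occs_def)
  qed
  \<comment> \<open>A multiset, since different letters may yield the same chain.\<close>
  define X where "X = image_mset (\<lambda>x. chain_of k (c x)) (mset_set (set xs))"
  have "\<forall>C\<in>#X. is_chain k m C" using c ck k by (auto simp: X_def is_chain_chain_of)
  moreover have False
    if Y: "Y \<subseteq># X" "size Y = r" and T: "finite T" "card T = s" "\<forall>C\<in>#Y. stabs T C" for Y T
  proof -
    obtain A where A: "A \<subseteq> set xs" "Y = image_mset (\<lambda>x. chain_of k (c x)) (mset_set A)"
      using Y(1) unfolding X_def by (rule subset_image_mset_mset_setE) simp
    have finA: "finite A" using A(1) finite_subset by blast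
    obtain u where u: "\<And>c. strict_mono_on {..k} c \<Longrightarrow> c k \<le> m \<Longrightarrow> stabs T (chain_of k c) \<Longrightarrow>
        hits (Suc s) u (c ` {..k})"
      using stabs_chain_of_imp_hits[OF T(1,2) s] by blast
    have "hits (Suc s) u (occs bs x)" if "x \<in> A" for x
    proof (rule hits_mono)
      have x: "x \<in> set xs" using that A(1) by auto
      show "hits (Suc s) u (c x ` {..k})"
        using T(3) A(2) that finA by (intro u c ck x) auto
      show "c x ` {..k} \<subseteq> occs bs x" by (rule c(2)[OF x])
    qed
    moreover have "card A = r" using A(2) Y(2) by simp
    moreover have "A \<noteq> {}" using \<open>card A = r\<close> r by auto
    ultimately show False
      using hits_occs_imp_formation[OF finA, of "Suc s" u bs] xs(3) bs(3)
      by (auto simp: avoids_formations_def)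
  qed
  moreover have "size X = n" by (simp add: X_def xs(1))
  ultimately show "n \<in> eta_sizes r s k m" unfolding eta_sizes_def by blast
qed

text \<open>The chains are numbered and the numbers serve as letters, so equal chains in
  \<open>X\<close> become different letters. Recency-ordered blocks turn a formation back into a
  stabbing tuple.\<close>

lemma eta_sizes_subset_F_sizes:
  assumes r: "1 \<le> r" and k: "1 \<le> k"
  shows "eta_sizes r s k m \<subseteq> F_sizes r (s + 1) (k + 1) (m + 1)"
proof
  fix n assume "n \<in> eta_sizes r s k m"
  then obtain X where X: "n = size X" "\<forall>C\<in>#X. is_chain k m C"
    "\<not> (\<exists>Y T. Y \<subseteq># X \<and> size Y = r \<and> finite T \<and> card T = s \<and> (\<forall>C\<in>#Y. stabs T C))"
    by (auto simp: eta_sizes_def)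
  obtain Cs where Cs: "mset Cs = X" using ex_mset by blast
  have len: "length Cs = n" using Cs X(1) by auto
  have "\<forall>x\<in>{..<n}. \<exists>c. strict_mono_on {..k} c \<and> c k \<le> m \<and> Cs ! x = chain_of k c"
  proof
    fix x assume "x \<in> {..<n}"
    then have "is_chain k m (Cs ! x)" using X(2) Cs len nth_mem by (metis lessThan_iff set_mset_mset)
    then show "\<exists>c. strict_mono_on {..k} c \<and> c k \<le> m \<and> Cs ! x = chain_of k c"
      using k by (metis is_chainE)
  qed
  then obtain c where c: "\<And>x. x < n \<Longrightarrow> strict_mono_on {..k} (c x)" "\<And>x. x < n \<Longrightarrow> c x k \<le> m"
    "\<And>x. x < n \<Longrightarrow> Cs ! x = chain_of k (c x)" by (metis lessThan_iff)
  have B: "c x ` {..k} \<subseteq> {..<m + 1}" if "x \<in> {..<n}" for x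
  proof safe
    fix i assume "i \<le> k"
    then have "c x i \<le> c x k"
      using strict_mono_onD[OF c(1), of x i k] that by (cases "i = k") auto
    then show "c x i < m + 1" using c(2)[of x] that by simp
  qed
  obtain bs where bs: "length bs = m + 1" "\<forall>b\<in>set bs. distinct b" "recency_ordered bs"
    "\<And>x. occs bs x = (if x \<in> {..<n} then c x ` {..k} else {})"
    using ex_recency_ordered[of "{..<n}" "\<lambda>x. c x ` {..k}" "m + 1"] B by blast
  let ?xs = "concat bs"
  have "x \<in> set ?xs \<longleftrightarrow> occs bs x \<noteq> {}" for x
    unfolding occs_def set_concat set_conv_nth[of bs] by blast
  then have "x \<in> set ?xs \<longleftrightarrow> x \<in> {..<n}" for x
    using bs(4)[of x] by (simp del: set_concat)
  then have set_xs: "set ?xs = {..<n}" by blast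
  have "on_blocks (m + 1) ?xs" using bs by (auto simp: on_blocks_def)
  moreover have "\<forall>a\<in>set ?xs. k + 1 \<le> count_list ?xs a"
  proof
    fix a assume "a \<in> set ?xs"
    then have a: "a < n" using set_xs by auto
    have "card (c a ` {..k}) = k + 1"
      using strict_mono_on_imp_inj_on[OF c(1)[OF a]] by (simp add: card_image)
    then show "k + 1 \<le> count_list ?xs a"
      using count_list_concat_eq_card_occs[OF bs(2), of a] bs(4)[of a] a by simp
  qed
  moreover have "avoids_formations r (s + 1) ?xs"
    unfolding avoids_formations_def
  proof
    assume "\<exists>ys. subseq ys ?xs \<and> formation r (s + 1) ys"
    then obtain A ps where A: "finite A" "card A = r" and ps: "length ps = s + 1"
      "\<forall>p\<in>set ps. p \<in> permutations_of_set A" "subseq (concat ps) ?xs"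
      by (auto simp: formation_def)
    have ne: "A \<noteq> {}" using A r by auto
    have perm: "\<forall>p\<in>set ps. set p = A" using ps(2) by (auto simp: permutations_of_set_def)
    obtain p where "p \<in> set ps" using ps(1) by (cases ps) auto
    then have "A \<subseteq> set (concat ps)" using perm by auto
    then have A_n: "A \<subseteq> {..<n}" using set_xs ps(3) by (fastforce elim: list_emb_set)
    obtain u where "\<forall>x\<in>A. hits (length ps) u (occs bs x)"
      using recency_ordered_formation_imp_hits[OF bs(2,3) ne perm, of 0] ps(3) by auto
    then have hit: "hits (Suc s) u (c x ` {..k})" if "x \<in> A" for x
      using that A_n bs(4)[of x] ps(1) by (auto simp: subset_iff)
    \<comment> \<open>The tuple consists of the \<open>s\<close> interior cut points between the
      \<open>s + 1\<close> groups.\<close>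
    let ?T = "int ` u ` {1..s}" and ?Y = "image_mset ((!) Cs) (mset_set A)"
    have "\<forall>C\<in>#?Y. stabs ?T C"
      using A(1) A_n c hit hits_imp_stabs_chain_of by (auto simp: subset_iff)
    moreover have "card ?T = s"
    proof -
      obtain x where "x \<in> A" using ne by auto
      then have "inj_on u {..Suc s}" by (intro strict_mono_on_imp_inj_on hits_strict_mono_on[OF hit])
      then have "inj_on u {1..s}" by (rule inj_on_subset) auto
      then show ?thesis by (simp add: card_image)
    qed
    moreover have "?Y \<subseteq># X"
    proof -
      have "image_mset ((!) Cs) (mset_set {..<n}) = mset (map ((!) Cs) [0..<n])"
        by (simp add: lessThan_atLeast0)
      also have "\<dots> = X" using Cs len by (metis map_nth)
      finally show ?thesis
        using image_mset_subseteq_mono[OF subset_imp_msubset_mset_set[OF A_n]] by fastforce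
    qed
    moreover have "size ?Y = r" using A by simp
    ultimately show False using X(3) by blast
  qed
  moreover have "card (set ?xs) = n" using set_xs by simp
  ultimately show "n \<in> F_sizes r (s + 1) (k + 1) (m + 1)" unfolding F_sizes_def by force
qed

theorem mainTheorem3:
  fixes r s k m :: nat
  assumes "1 \<le> r" and "1 \<le> s" and "s \<le> k" and "k \<le> m"
  shows "eta r s k m = F r (s + 1) (k + 1) (m + 1)"
proof -
  \<comment> \<open>Already the sets of attainable sizes coincide, not only their maxima.\<close>
  have "eta_sizes r s k m = F_sizes r (s + 1) (k + 1) (m + 1)"
    using assms F_sizes_subset_eta_sizes eta_sizes_subset_F_sizes
    by (intro antisym) auto
  then show ?thesis by (simp add: eta_def F_def)
qed

end
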